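(* Let $\mathcal{H}$ be a separable real Hilbert space, and let $A:\mathcal{H}\to 2^{\mathcal{H}}$, $B=\sum_{i=1}^N B_i:\mathcal{H}\to\mathcal{H}$ and $C:\mathcal{H}\to\mathcal{H}$ satisfy the following: (i) $A$ is maximally monotone; (ii) each $B_i:\mathcal H\to\mathcal H$ is $L_i$-Lipschitz, and $B$ has a stochastic oracle $B_\xi$ (with $\xi\sim Q$) that is unbiased, $B(x)=\mathbb{E}[B_\xi(x)]$ for all $x\in\mathcal H$, and $L$-Lipschitz in mean with $L>0$, i.e. $\mathbb{E}[\|B_\xi(u)-B_\xi(v)\|^2]\le L^2\|u-v\|^2$ for all $u,v\in\mathcal{H}$; (iii) $C$ is $\beta$-cocoercive with $\beta>0$; (iv) the solution set $\{x\in\mathcal H: 0\in (A+B+C)(x)\}$ is nonempty. Suppose moreover that $B$ is $\mu$-strongly monotone with $\mu>0$, and let $x^*$ be the solution of $0\in(A+B+C)(x)$. Let $p\in(0,1)$, $\lambda=1-p$ and $$\gamma=\min\left\{\frac{\sqrt p}{2L},\ \beta p\right\},$$ and let $\{x^k\}_{k\in\mathbb N}$ be generated by the algorithm VRFBHF (defined in the context) with parameters $p,Q,\gamma,\lambda$. Then for all $k\in\mathbb N$, $$\mathbb{E}\|x^k-x^*\|^2\le\left(\frac{1}{1+c/4}\right)^k\frac{2}{1-p}\,\|x^0-x^*\|^2,\qquad\text{where } c=\min\left\{\gamma\mu,\ \frac{p}{(1+\sqrt p)(4+p)}\right\}.$$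
   Context: $\mathbb N$ is the set of nonnegative integers. An operator $T:\mathcal H\to\mathcal H$ is $\beta$-cocoercive if $\langle Tx-Ty,x-y\rangle\ge\beta\|Tx-Ty\|^2$ for all $x,y\in\mathcal H$, and $\mu$-strongly monotone if $\langle Tx-Ty,x-y\rangle\ge\mu\|x-y\|^2$ for all $x,y\in\mathcal H$. The resolvent of $A$ is $J_{\gamma A}=(\mathrm{Id}+\gamma A)^{-1}$, which is single-valued and everywhere defined for $A$ maximally monotone and $\gamma>0$. Stochastic oracle: $Q$ is a probability distribution on $\{1,\dots,N\}$, and for each value of $\xi\in\{1,\dots,N\}$ there is an operator $B_\xi:\mathcal H\to\mathcal H$; expectations $\mathbb E[B_\xi(x)]$ and $\mathbb{E}[\|B_\xi(u)-B_\xi(v)\|^2]$ are over $\xi\sim Q$. (Example: $Q(i)>0$ and $B_\xi=\frac{1}{Q(i)}B_i$ when $\xi=i$.) Algorithm VRFBHF. Input: $p\in(0,1]$, $Q$, step-size $\gamma$, $\lambda$; a (deterministic) starting point $x^0=w^0\in\mathcal H$. For $k=0,1,2,\dots$: 1. $\bar x^k=\lambda x^k+(1-\lambda)w^k$; 2. $y^k=J_{\gamma A}\big(\bar x^k-\gamma(B+C)w^k\big)$; 3. draw $\xi_k\sim Q$, independently of the past; 4. $x^{k+1}=y^k+\gamma(B_{\xi_k}w^k-B_{\xi_k}y^k)$; 5. $w^{k+1}=x^{k+1}$ with probability $p$, and $w^{k+1}=w^k$ with probability $1-p$ (this choice being made independently of $\xi_k$ and of the past). All random variables live on a common probability space, and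 $\mathbb E$ denotes full expectation. *)

theory Defs
  imports "HOL-Probability.Probability"
begin

definition monotone_op :: "('h::real_inner \<Rightarrow> 'h set) \<Rightarrow> bool" where
  "monotone_op A \<longleftrightarrow> (\<forall>x y. \<forall>u\<in>A x. \<forall>v\<in>A y. inner (u - v) (x - y) \<ge> 0)"

definition maximally_monotone :: "('h::real_inner \<Rightarrow> 'h set) \<Rightarrow> bool" where
  "maximally_monotone A \<longleftrightarrow>
     monotone_op A \<and> (\<forall>A'. monotone_op A' \<and> (\<forall>x. A x \<subseteq> A' x) \<longrightarrow> A' = A)"

definition cocoercive :: "real \<Rightarrow> ('h::real_inner \<Rightarrow> 'h) \<Rightarrow> bool" where
  "cocoercive \<beta> T \<longleftrightarrow> (\<forall>x y. inner (T x - T y) (x - y) \<ge> \<beta> * (norm (T x - T y))\<^sup>2)"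

definition strongly_monotone :: "real \<Rightarrow> ('h::real_inner \<Rightarrow> 'h) \<Rightarrow> bool" where
  "strongly_monotone \<mu> T \<longleftrightarrow> (\<forall>x y. inner (T x - T y) (x - y) \<ge> \<mu> * (norm (x - y))\<^sup>2)"

definition inverse_op :: "('a \<Rightarrow> 'b set) \<Rightarrow> 'b \<Rightarrow> 'a set" where
  "inverse_op F z = {x. z \<in> F x}"

text \<open>
  The resolvent is kept as the set-valued inverse of Id + gamma A. For a maximally monotone A and
  gamma > 0 every value is a singleton, so that the equation y = J z reads
  \<open>y \<in> resolvent \<gamma> A z\<close>; lemma \<open>resolvent_unique\<close> is the uniqueness half
  of this.
\<close>

definition resolvent :: "real \<Rightarrow> ('h::real_inner \<Rightarrow> 'h set) \<Rightarrow> 'h \<Rightarrow> 'h set" where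
  "resolvent \<gamma> A = inverse_op (\<lambda>x. {x + \<gamma> *\<^sub>R u |u. u \<in> A x})"

lemma resolvent_unique:
  assumes "monotone_op A" "\<gamma> \<ge> 0" "y \<in> resolvent \<gamma> A z" "y' \<in> resolvent \<gamma> A z"
  shows "y = y'"
proof -
  obtain u where u: "u \<in> A y" "z = y + \<gamma> *\<^sub>R u"
    using assms(3) by (auto simp: resolvent_def inverse_op_def)
  obtain v where v: "v \<in> A y'" "z = y' + \<gamma> *\<^sub>R v"
    using assms(4) by (auto simp: resolvent_def inverse_op_def)
  have "y - y' = - (\<gamma> *\<^sub>R (u - v))"
    using u(2) v(2) by (simp add: algebra_simps)
  then have "inner (y - y') (y - y') = - (\<gamma> * inner (u - v) (y - y'))"
    by (metis inner_minus_left inner_scaleR_left)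
  moreover have "\<gamma> * inner (u - v) (y - y') \<ge> 0"
    using assms(1,2) u(1) v(1) by (auto simp: monotone_op_def)
  ultimately show ?thesis
    by (metis eq_iff_diff_eq_0 inner_ge_zero inner_eq_zero_iff neg_le_0_iff_le order_antisym)
qed

definition solution_set ::
    "('h::real_inner \<Rightarrow> 'h set) \<Rightarrow> ('h \<Rightarrow> 'h) \<Rightarrow> ('h \<Rightarrow> 'h) \<Rightarrow> 'h set" where
  "solution_set A B C = {x. 0 \<in> {a + B x + C x |a. a \<in> A x}}"

definition unbiased_oracle ::
    "nat pmf \<Rightarrow> (nat \<Rightarrow> 'h \<Rightarrow> 'h) \<Rightarrow> ('h \<Rightarrow> 'h::{real_inner,banach,second_countable_topology}) \<Rightarrow> bool" where
  "unbiased_oracle Q Bo B \<longleftrightarrow> (\<forall>x. B x = measure_pmf.expectation Q (\<lambda>i. Bo i x))"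

definition lipschitz_in_mean ::
    "real \<Rightarrow> nat pmf \<Rightarrow> (nat \<Rightarrow> 'h \<Rightarrow> 'h::real_inner) \<Rightarrow> bool" where
  "lipschitz_in_mean L Q Bo \<longleftrightarrow>
     (\<forall>u v. measure_pmf.expectation Q (\<lambda>i. (norm (Bo i u - Bo i v))\<^sup>2) \<le> L\<^sup>2 * (norm (u - v))\<^sup>2)"

definition events_of :: "'w measure \<Rightarrow> ('w \<Rightarrow> 'b) \<Rightarrow> 'w set set" where
  "events_of M X = {X -` S \<inter> space M |S. True}"

text \<open>
  The sigma-algebra of the draws made before iteration k. The starting point being deterministic,
  all iterates available at the beginning of iteration k are functions of these draws.
\<close>

definition past ::
    "'w measure \<Rightarrow> (nat \<Rightarrow> 'w \<Rightarrow> nat) \<Rightarrow> (nat \<Rightarrow> 'w \<Rightarrow> bool) \<Rightarrow> nat \<Rightarrow> 'w set set" where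
  "past M \<xi> \<zeta> k = sigma_sets (space M) (\<Union>j<k. events_of M (\<xi> j) \<union> events_of M (\<zeta> j))"

text \<open>
  \<open>\<xi> k\<close> is the oracle index drawn in iteration k and \<open>\<zeta> k\<close> the coin deciding whether the
  reference point w is refreshed.
\<close>

definition VRFBHF_draws ::
    "'w measure \<Rightarrow> real \<Rightarrow> nat pmf \<Rightarrow> (nat \<Rightarrow> 'w \<Rightarrow> nat) \<Rightarrow> (nat \<Rightarrow> 'w \<Rightarrow> bool) \<Rightarrow> bool" where
  "VRFBHF_draws M p Q \<xi> \<zeta> \<longleftrightarrow>
     (\<forall>k. \<xi> k \<in> M \<rightarrow>\<^sub>M count_space UNIV \<and>
          \<zeta> k \<in> M \<rightarrow>\<^sub>M count_space UNIV \<and>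
          distr M (count_space UNIV) (\<xi> k) = measure_pmf Q \<and>
          measure M {\<omega>\<in>space M. \<zeta> k \<omega>} = p \<and>
          prob_space.indep_set M (events_of M (\<xi> k)) (past M \<xi> \<zeta> k) \<and>
          prob_space.indep_set M (events_of M (\<zeta> k))
            (sigma_sets (space M) (past M \<xi> \<zeta> k \<union> events_of M (\<xi> k))))"

definition VRFBHF ::
    "'w measure \<Rightarrow> ('h::real_inner \<Rightarrow> 'h set) \<Rightarrow> ('h \<Rightarrow> 'h) \<Rightarrow> (nat \<Rightarrow> 'h \<Rightarrow> 'h) \<Rightarrow> ('h \<Rightarrow> 'h) \<Rightarrow>
     real \<Rightarrow> nat pmf \<Rightarrow> real \<Rightarrow> real \<Rightarrow> 'h \<Rightarrow>
     (nat \<Rightarrow> 'w \<Rightarrow> nat) \<Rightarrow> (nat \<Rightarrow> 'w \<Rightarrow> bool) \<Rightarrow>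
     (nat \<Rightarrow> 'w \<Rightarrow> 'h) \<Rightarrow> (nat \<Rightarrow> 'w \<Rightarrow> 'h) \<Rightarrow> (nat \<Rightarrow> 'w \<Rightarrow> 'h) \<Rightarrow> bool" where
  "VRFBHF M A B Bo C p Q \<gamma> lam x0 \<xi> \<zeta> x w y \<longleftrightarrow>
     VRFBHF_draws M p Q \<xi> \<zeta> \<and>
     (\<forall>\<omega>\<in>space M.
        x 0 \<omega> = x0 \<and> w 0 \<omega> = x0 \<and>
        (\<forall>k. y k \<omega> \<in> resolvent \<gamma> A
                 ((lam *\<^sub>R x k \<omega> + (1 - lam) *\<^sub>R w k \<omega>) - \<gamma> *\<^sub>R (B (w k \<omega>) + C (w k \<omega>))) \<and>
             x (Suc k) \<omega> = y k \<omega> + \<gamma> *\<^sub>R (Bo (\<xi> k \<omega>) (w k \<omega>) - Bo (\<xi> k \<omega>) (y k \<omega>)) \<and>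
             w (Suc k) \<omega> = (if \<zeta> k \<omega> then x (Suc k) \<omega> else w k \<omega>)))"

end

theory Submission
  imports Defs
begin

text \<open>
  The proof is a Lyapunov argument for
  \<open>\<Phi>(x, w) = (1 - p) \<parallel>x - x\<^sup>*\<parallel>\<^sup>2 + \<parallel>w - x\<^sup>*\<parallel>\<^sup>2\<close>.
  Write \<open>y\<close> for the resolvent point computed from the state \<open>(x, w)\<close> and \<open>x\<^sup>+\<close> for
  its stochastic correction. Monotonicity of \<open>A\<close> between \<open>y\<close> and \<open>x\<^sup>*\<close>, cocoercivity of
  \<open>C\<close>, strong monotonicity of \<open>B\<close>, and unbiasedness and mean Lipschitz continuity of the oracle bound
  \<open>E \<parallel>x\<^sup>+ - x\<^sup>*\<parallel>\<^sup>2\<close> by \<open>(1 - p) \<parallel>x - x\<^sup>*\<parallel>\<^sup>2 + p \<parallel>w - x\<^sup>*\<parallel>\<^sup>2\<close> minus the dissipation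
  \<open>p/4 \<parallel>w - y\<parallel>\<^sup>2 + 2 \<gamma> \<mu> \<parallel>y - x\<^sup>*\<parallel>\<^sup>2\<close>
  (lemmas \<open>forward_backward_inequality\<close> and \<open>expected_corrected_point_le\<close>). The step size
  enters twice: \<open>\<gamma> \<le> \<beta> p\<close> makes the cocoercivity error cost at most \<open>p/2\<close> of the available
  \<open>p \<parallel>w - y\<parallel>\<^sup>2\<close>, and \<open>\<gamma> \<le> sqrt p / (2 L)\<close> makes the oracle noise cost at most \<open>p/4\<close> of it.

  The weights in \<open>\<Phi>\<close> are those for which the refresh coin fits this estimate: averaging
  \<open>\<Phi>\<close> over the coin gives \<open>\<parallel>x\<^sup>+ - x\<^sup>*\<parallel>\<^sup>2 + (1 - p) \<parallel>w - x\<^sup>*\<parallel>\<^sup>2\<close>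
  (lemma \<open>lyapunov_coin_average\<close>), so the estimate becomes
  \<open>E \<Phi>\<^sup>+ \<le> \<Phi>\<close> minus the dissipation. Both distances in \<open>E \<Phi>\<^sup>+\<close> are reached through \<open>y\<close>, hence
  \<open>E \<Phi>\<^sup>+ \<le> 4 \<parallel>y - x\<^sup>*\<parallel>\<^sup>2 + 4 \<parallel>w - y\<parallel>\<^sup>2\<close>, and the dissipation is at least \<open>c/4\<close> times this.
  The result is \<open>(1 + c/4) E \<Phi>\<^sup>+ \<le> \<Phi>\<close> (lemma \<open>lyapunov_contraction\<close>). Iterating it, and comparing
  \<open>(1 - p) \<parallel>x - x\<^sup>*\<parallel>\<^sup>2 \<le> \<Phi>(x, w)\<close> at the end with
  \<open>\<Phi>(x\<^sub>0, x\<^sub>0) = (2 - p) \<parallel>x\<^sub>0 - x\<^sup>*\<parallel>\<^sup>2\<close> at the start, gives the theorem.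

  The contraction holds with the state fixed. To integrate it over the past, note that all draws are
  discrete, so the state \<open>(x\<^sub>k, w\<^sub>k)\<close> takes countably many values and is determined by the past
  draws. Its joint law with the fresh draws is then a product measure on a countable set, and Tonelli's
  theorem replaces conditional expectations (lemma \<open>nn_integral_fresh_draws\<close>). Working with
  integrals of nonnegative functions makes integrability of the iterates a consequence of the final
  bound.
\<close>

section \<open>One iteration with a fixed state\<close>

lemma three_point_identity:
  fixes a x y :: "'h::real_inner"
  shows "2 * inner (x - y) (y - a) = (norm (x - a))\<^sup>2 - (norm (x - y))\<^sup>2 - (norm (y - a))\<^sup>2"
  unfolding power2_norm_eq_inner by (simp add: algebra_simps inner_commute)

lemma norm_add_squared_le:
  fixes u v :: "'h::real_inner"
  shows "(norm (u + v))\<^sup>2 \<le> 2 * (norm u)\<^sup>2 + 2 * (norm v)\<^sup>2"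
  using zero_le_power2[of "norm (u - v)"]
  unfolding power2_norm_eq_inner by (simp add: algebra_simps inner_commute)

text \<open>
  Splitting \<open>y - a\<close> into \<open>(w - a) - (w - y)\<close> leaves a nonpositive cocoercive part that
  absorbs the square of \<open>C w - C a\<close> produced by Young's inequality with weight \<open>\<beta>\<close>. This is why the
  forward step may use \<open>C\<close> at \<open>w\<close> although the estimate is centred at \<open>y\<close>.
\<close>

lemma cocoercive_cross_term:
  fixes a w y :: "'h::real_inner"
  assumes "cocoercive \<beta> C" "\<beta> > 0"
  shows "- inner (C w - C a) (y - a) \<le> (norm (w - y))\<^sup>2 / (4 * \<beta>)"
proof -
  let ?d = "C w - C a"
  have "\<beta> * (norm ?d)\<^sup>2 \<le> inner ?d (w - a)"
    using assms(1) by (simp add: cocoercive_def)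
  moreover have "inner ?d (y - a) = inner ?d (w - a) - inner ?d (w - y)"
    by (simp add: inner_diff_right)
  moreover have "inner ?d (w - y) \<le> norm ?d * norm (w - y)"
    by (rule norm_cauchy_schwarz)
  moreover have "norm ?d * norm (w - y) \<le> \<beta> * (norm ?d)\<^sup>2 + (norm (w - y))\<^sup>2 / (4 * \<beta>)"
  proof -
    have "0 \<le> (2 * \<beta> * norm ?d - norm (w - y))\<^sup>2 / (4 * \<beta>)"
      using assms(2) by simp
    also have "\<dots> = \<beta> * (norm ?d)\<^sup>2 - norm ?d * norm (w - y) + (norm (w - y))\<^sup>2 / (4 * \<beta>)"
      using assms(2) by (simp add: field_simps power2_eq_square)
    finally show ?thesis by simp
  qed
  ultimately show ?thesis by linarith
qed

text \<open>
  This is monotonicity of \<open>A\<close> tested at \<open>y\<close> and \<open>a\<close>: the resolvent equation supplies the element of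
  \<open>A y\<close>, the inclusion \<open>0 \<in> (A + B + C) a\<close> supplies \<open>- B a - C a \<in> A a\<close>. The three-point
  identity, applied to both parts of the combination of \<open>x\<close> and \<open>w\<close>, turns the inner
  products into squared distances.
\<close>

lemma forward_backward_inequality:
  fixes a w x y :: "'h::real_inner"
  assumes A: "monotone_op A" and a: "a \<in> solution_set A B C"
    and C: "cocoercive \<beta> C" "\<beta> > 0"
    and \<gamma>: "\<gamma> > 0" "\<gamma> \<le> \<beta> * p"
    and y: "y \<in> resolvent \<gamma> A (((1 - p) *\<^sub>R x + p *\<^sub>R w) - \<gamma> *\<^sub>R (B w + C w))"
  shows "(norm (y - a))\<^sup>2 + 2 * \<gamma> * inner (B w - B a) (y - a)
    \<le> (1 - p) * (norm (x - a))\<^sup>2 + p * (norm (w - a))\<^sup>2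
      - (1 - p) * (norm (x - y))\<^sup>2 - p / 2 * (norm (w - y))\<^sup>2"
proof -
  obtain u where u: "u \<in> A y"
      "((1 - p) *\<^sub>R x + p *\<^sub>R w) - \<gamma> *\<^sub>R (B w + C w) = y + \<gamma> *\<^sub>R u"
    using y by (auto simp: resolvent_def inverse_op_def)
  obtain v where v: "v \<in> A a" "0 = v + B a + C a"
    using a by (auto simp: solution_set_def)
  have v': "v = - (B a + C a)"
    using v(2) by (metis add.assoc eq_neg_iff_add_eq_0)
  have \<gamma>u: "\<gamma> *\<^sub>R u = (1 - p) *\<^sub>R (x - y) + p *\<^sub>R (w - y) - \<gamma> *\<^sub>R (B w + C w)"
    using u(2) by (simp add: algebra_simps)
  have "0 \<le> \<gamma> * inner (u - v) (y - a)"
    using A u(1) v(1) \<gamma>(1) by (simp add: monotone_op_def)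
  also have "\<dots> = inner (\<gamma> *\<^sub>R u - \<gamma> *\<^sub>R v) (y - a)"
    by (simp add: algebra_simps)
  also have "\<dots> = (1 - p) * inner (x - y) (y - a) + p * inner (w - y) (y - a)
      - \<gamma> * inner (B w - B a) (y - a) - \<gamma> * inner (C w - C a) (y - a)"
    unfolding \<gamma>u v' by (simp add: algebra_simps)
  finally have "2 * \<gamma> * inner (B w - B a) (y - a)
      \<le> (1 - p) * (2 * inner (x - y) (y - a)) + p * (2 * inner (w - y) (y - a))
        + 2 * \<gamma> * (- inner (C w - C a) (y - a))"
    by (simp add: algebra_simps)
  moreover have "2 * \<gamma> * (- inner (C w - C a) (y - a)) \<le> p / 2 * (norm (w - y))\<^sup>2"
  proof -
    have "2 * \<gamma> * (- inner (C w - C a) (y - a)) \<le> 2 * \<gamma> * ((norm (w - y))\<^sup>2 / (4 * \<beta>))"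
      using cocoercive_cross_term[OF C] \<gamma>(1) by (intro mult_left_mono) auto
    also have "\<dots> = \<gamma> / \<beta> * ((norm (w - y))\<^sup>2 / 2)"
      using C(2) by (simp add: field_simps)
    also have "\<dots> \<le> p * ((norm (w - y))\<^sup>2 / 2)"
      using C(2) \<gamma>(2) by (intro mult_right_mono) (auto simp: field_simps)
    finally show ?thesis by simp
  qed
  ultimately show ?thesis
    unfolding three_point_identity by (simp add: algebra_simps)
qed

text \<open>
  The correction replaces \<open>B w\<close> by \<open>B y\<close> in the forward step, in expectation: added to
  \<open>forward_backward_inequality\<close>, the inner product here leaves only \<open>B y - B a\<close>, to which
  strong monotonicity applies.
\<close>

lemma expected_corrected_point_le:
  fixes a w y :: "'h::{real_inner,banach,second_countable_topology}"
  assumes fin: "finite (set_pmf Q)"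
    and ub: "unbiased_oracle Q Bo B" and lip: "lipschitz_in_mean L Q Bo"
  shows "measure_pmf.expectation Q (\<lambda>i. (norm (y + \<gamma> *\<^sub>R (Bo i w - Bo i y) - a))\<^sup>2)
    \<le> (norm (y - a))\<^sup>2 + 2 * \<gamma> * inner (B w - B y) (y - a) + \<gamma>\<^sup>2 * L\<^sup>2 * (norm (w - y))\<^sup>2"
proof -
  note [simp] = integrable_measure_pmf_finite[OF fin]
  let ?\<Delta> = "\<lambda>i. Bo i w - Bo i y"
  have mean: "measure_pmf.expectation Q ?\<Delta> = B w - B y"
    using ub by (simp add: unbiased_oracle_def)
  have "measure_pmf.expectation Q (\<lambda>i. (norm (y + \<gamma> *\<^sub>R ?\<Delta> i - a))\<^sup>2)
      = measure_pmf.expectation Q (\<lambda>i. (norm (y - a))\<^sup>2 + 2 * \<gamma> * inner (?\<Delta> i) (y - a)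
          + \<gamma>\<^sup>2 * (norm (?\<Delta> i))\<^sup>2)"
    unfolding power2_norm_eq_inner
    by (intro Bochner_Integration.integral_cong refl)
      (simp add: algebra_simps inner_commute power2_eq_square)
  also have "\<dots> = (norm (y - a))\<^sup>2 + 2 * \<gamma> * measure_pmf.expectation Q (\<lambda>i. inner (?\<Delta> i) (y - a))
      + \<gamma>\<^sup>2 * measure_pmf.expectation Q (\<lambda>i. (norm (?\<Delta> i))\<^sup>2)"
    by (simp add: Bochner_Integration.integral_add)
  also have "measure_pmf.expectation Q (\<lambda>i. inner (?\<Delta> i) (y - a)) = inner (B w - B y) (y - a)"
    unfolding mean[symmetric] by (rule integral_inner_left) simp
  also have "\<gamma>\<^sup>2 * measure_pmf.expectation Q (\<lambda>i. (norm (?\<Delta> i))\<^sup>2) \<le> \<gamma>\<^sup>2 * (L\<^sup>2 * (norm (w - y))\<^sup>2)"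
    using lip by (intro mult_left_mono) (auto simp: lipschitz_in_mean_def)
  finally show ?thesis by simp
qed

text \<open>
  A cruder bound for the same quantity, free of inner products. It measures how much of the
  dissipation is needed to pay for a fraction of the new distance.
\<close>

lemma expected_corrected_point_crude_bound:
  fixes a w y :: "'h::{real_inner,banach,second_countable_topology}"
  assumes fin: "finite (set_pmf Q)" and lip: "lipschitz_in_mean L Q Bo"
  shows "measure_pmf.expectation Q (\<lambda>i. (norm (y + \<gamma> *\<^sub>R (Bo i w - Bo i y) - a))\<^sup>2)
    \<le> 2 * (norm (y - a))\<^sup>2 + 2 * (\<gamma>\<^sup>2 * L\<^sup>2) * (norm (w - y))\<^sup>2"
proof -
  note [simp] = integrable_measure_pmf_finite[OF fin]
  let ?\<Delta> = "\<lambda>i. Bo i w - Bo i y"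
  have "measure_pmf.expectation Q (\<lambda>i. (norm (y + \<gamma> *\<^sub>R ?\<Delta> i - a))\<^sup>2)
      \<le> measure_pmf.expectation Q (\<lambda>i. 2 * (norm (y - a))\<^sup>2 + 2 * \<gamma>\<^sup>2 * (norm (?\<Delta> i))\<^sup>2)"
  proof (intro integral_mono)
    fix i
    have eq: "y + \<gamma> *\<^sub>R ?\<Delta> i - a = (y - a) + \<gamma> *\<^sub>R ?\<Delta> i"
      by simp
    show "(norm (y + \<gamma> *\<^sub>R ?\<Delta> i - a))\<^sup>2 \<le> 2 * (norm (y - a))\<^sup>2 + 2 * \<gamma>\<^sup>2 * (norm (?\<Delta> i))\<^sup>2"
      unfolding eq using norm_add_squared_le[of "y - a" "\<gamma> *\<^sub>R ?\<Delta> i"]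
      by (simp add: power_mult_distrib)
  qed simp_all
  also have "\<dots> = 2 * (norm (y - a))\<^sup>2 + 2 * \<gamma>\<^sup>2 * measure_pmf.expectation Q (\<lambda>i. (norm (?\<Delta> i))\<^sup>2)"
    by simp
  also have "2 * \<gamma>\<^sup>2 * measure_pmf.expectation Q (\<lambda>i. (norm (?\<Delta> i))\<^sup>2) \<le> 2 * \<gamma>\<^sup>2 * (L\<^sup>2 * (norm (w - y))\<^sup>2)"
    using lip by (intro mult_left_mono) (auto simp: lipschitz_in_mean_def)
  finally show ?thesis by (simp add: algebra_simps)
qed

text \<open>
  The expectation on the left is over the oracle index; together with the \<open>w\<close> term it is the
  Lyapunov function of the next state averaged over all fresh draws. The inequality compares the
  dissipation with \<open>c/4\<close> times the left-hand side: the part of \<open>c\<close> bounded by \<open>\<gamma> \<mu>\<close> is paid by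
  \<open>\<parallel>y - a\<parallel>\<^sup>2\<close>, the part bounded by \<open>p/4\<close> by \<open>\<parallel>w - y\<parallel>\<^sup>2\<close>.
\<close>

lemma lyapunov_contraction:
  fixes a w x y :: "'h::{real_inner,banach,second_countable_topology}"
  assumes A: "monotone_op A" and a: "a \<in> solution_set A B C"
    and C: "cocoercive \<beta> C" "\<beta> > 0"
    and B: "strongly_monotone \<mu> B"
    and fin: "finite (set_pmf Q)"
    and ub: "unbiased_oracle Q Bo B" and lip: "lipschitz_in_mean L Q Bo"
    and p: "0 < p" "p < 1"
    and \<gamma>: "\<gamma> > 0" "\<gamma> \<le> \<beta> * p" "\<gamma>\<^sup>2 * L\<^sup>2 \<le> p / 4"
    and c: "0 \<le> c" "c \<le> \<gamma> * \<mu>" "c \<le> p / ((1 + sqrt p) * (4 + p))"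
    and y: "y \<in> resolvent \<gamma> A (((1 - p) *\<^sub>R x + p *\<^sub>R w) - \<gamma> *\<^sub>R (B w + C w))"
  shows "(1 + c / 4) * (measure_pmf.expectation Q
      (\<lambda>i. (norm (y + \<gamma> *\<^sub>R (Bo i w - Bo i y) - a))\<^sup>2) + (1 - p) * (norm (w - a))\<^sup>2)
    \<le> (1 - p) * (norm (x - a))\<^sup>2 + (norm (w - a))\<^sup>2"
proof -
  define E where "E = measure_pmf.expectation Q (\<lambda>i. (norm (y + \<gamma> *\<^sub>R (Bo i w - Bo i y) - a))\<^sup>2)"
  define X where "X = (norm (x - a))\<^sup>2"
  define W where "W = (norm (w - a))\<^sup>2"
  define Y where "Y = (norm (y - a))\<^sup>2"
  define D where "D = (norm (w - y))\<^sup>2"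
  have nonneg: "Y \<ge> 0" "D \<ge> 0" "(1 - p) * (norm (x - y))\<^sup>2 \<ge> 0"
    using p by (simp_all add: Y_def D_def)
  have gLD: "\<gamma>\<^sup>2 * L\<^sup>2 * D \<le> p / 4 * D"
    using \<gamma>(3) nonneg(2) by (rule mult_right_mono)
  have "inner (B w - B y) (y - a) = inner (B w - B a) (y - a) - inner (B y - B a) (y - a)"
    by (simp add: algebra_simps)
  moreover have "\<mu> * Y \<le> inner (B y - B a) (y - a)"
    using B by (simp add: strongly_monotone_def Y_def)
  ultimately have "\<gamma> * inner (B w - B y) (y - a) \<le> \<gamma> * (inner (B w - B a) (y - a) - \<mu> * Y)"
    using \<gamma>(1) by (intro mult_left_mono) auto
  then have B_le: "2 * \<gamma> * inner (B w - B y) (y - a)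
      \<le> 2 * \<gamma> * inner (B w - B a) (y - a) - 2 * (\<gamma> * \<mu> * Y)"
    by (simp add: algebra_simps)
  have descent: "E + (1 - p) * W \<le> (1 - p) * X + W - p / 4 * D - 2 * (\<gamma> * \<mu> * Y)"
    using expected_corrected_point_le[OF fin ub lip, of y \<gamma> w a]
      forward_backward_inequality[OF A a C \<gamma>(1,2) y] B_le gLD nonneg
    unfolding E_def[symmetric] X_def[symmetric] W_def[symmetric] Y_def[symmetric] D_def[symmetric]
    by (simp add: algebra_simps)
  have "E \<le> 2 * Y + p / 2 * D"
    using expected_corrected_point_crude_bound[OF fin lip, of y \<gamma> w a] gLD
    unfolding E_def[symmetric] Y_def[symmetric] D_def[symmetric] by simp
  moreover have "(1 - p) * W \<le> 2 * Y + 2 * D"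
  proof -
    have "W \<le> 2 * Y + 2 * D"
      using norm_add_squared_le[of "y - a" "w - y"] by (simp add: W_def Y_def D_def)
    moreover have "(1 - p) * W \<le> 1 * W"
      using p by (intro mult_right_mono) (auto simp: W_def)
    ultimately show ?thesis by simp
  qed
  moreover have "p / 2 * D \<le> 1 / 2 * D"
    using p nonneg(2) by (intro mult_right_mono) auto
  ultimately have "E + (1 - p) * W \<le> 4 * Y + 4 * D"
    using nonneg by linarith
  then have "c / 4 * (E + (1 - p) * W) \<le> c / 4 * (4 * Y + 4 * D)"
    using c(1) by (intro mult_left_mono) auto
  also have "\<dots> = c * Y + c * D"
    by (simp add: algebra_simps)
  also have "c * Y \<le> \<gamma> * \<mu> * Y"
    using c(2) nonneg(1) by (rule mult_right_mono)
  also have "c * D \<le> p / 4 * D"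
  proof -
    have "1 * 4 \<le> (1 + sqrt p) * (4 + p)"
      using p by (intro mult_mono) auto
    then have "p / ((1 + sqrt p) * (4 + p)) \<le> p / 4"
      using p by (intro divide_left_mono) auto
    with c(3) have "c \<le> p / 4"
      by (rule order_trans)
    then show ?thesis
      using nonneg(2) by (rule mult_right_mono)
  qed
  finally have "c / 4 * (E + (1 - p) * W) \<le> \<gamma> * \<mu> * Y + p / 4 * D"
    by simp
  moreover have "0 \<le> \<gamma> * \<mu> * Y"
    using c(1,2) nonneg(1) by (meson mult_nonneg_nonneg order_trans)
  ultimately have "(1 + c / 4) * (E + (1 - p) * W) \<le> (1 - p) * X + W"
    using descent by (simp add: distrib_right)
  then show ?thesis
    unfolding E_def X_def W_def .
qed

section \<open>Random variables with countably many values\<close>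

text \<open>
  Measurability with respect to \<open>G\<close>, for the discrete structure on the target type. Countability of
  the range makes this notion stable under pairing and lets values in a Hilbert space be treated
  as values in a countable set.
\<close>

definition discretely_measurable :: "'w measure \<Rightarrow> 'w set set \<Rightarrow> ('w \<Rightarrow> 'a) \<Rightarrow> bool" where
  "discretely_measurable M G X \<longleftrightarrow> countable (X ` space M) \<and> events_of M X \<subseteq> G"

lemma discretely_measurable_mono:
  "discretely_measurable M G X \<Longrightarrow> G \<subseteq> G' \<Longrightarrow> discretely_measurable M G' X"
  by (auto simp: discretely_measurable_def)

lemma discretely_measurable_const:
  assumes "sigma_algebra (space M) G" "\<And>\<omega>. \<omega> \<in> space M \<Longrightarrow> X \<omega> = v"
  shows "discretely_measurable M G X"
proof -
  interpret sigma_algebra "space M" G by fact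
  have "X -` S \<inter> space M = (if v \<in> S then space M else {})" for S
    using assms(2) by auto
  moreover have "countable (X ` space M)"
    using assms(2) countable_subset[of "X ` space M" "{v}"] by auto
  ultimately show ?thesis
    by (auto simp: discretely_measurable_def events_of_def)
qed

lemma discretely_measurable_Pair:
  assumes "sigma_algebra (space M) G"
    and X: "discretely_measurable M G X" and Y: "discretely_measurable M G Y"
  shows "discretely_measurable M G (\<lambda>\<omega>. (X \<omega>, Y \<omega>))"
proof -
  interpret sigma_algebra "space M" G by fact
  let ?R = "(X ` space M) \<times> (Y ` space M)"
  have cnt: "countable ?R"
    using X Y by (simp add: discretely_measurable_def)
  have sing: "X -` {u} \<inter> space M \<in> G" "Y -` {v} \<inter> space M \<in> G" for u v
    using X Y unfolding discretely_measurable_def events_of_def by blast+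
  have "(\<lambda>\<omega>. (X \<omega>, Y \<omega>)) -` S \<inter> space M \<in> G" for S
  proof -
    \<comment> \<open>An arbitrary set of pairs need not be a countable union of rectangles, but its trace on the
      range is a countable union of points.\<close>
    have "(\<lambda>\<omega>. (X \<omega>, Y \<omega>)) -` S \<inter> space M
        = (\<Union>(u, v)\<in>S \<inter> ?R. (X -` {u} \<inter> space M) \<inter> (Y -` {v} \<inter> space M))"
      by auto
    also have "\<dots> \<in> G"
      using cnt sing by (intro countable_UN'') (auto intro: countable_subset[of _ ?R])
    finally show ?thesis .
  qed
  then show ?thesis
    using countable_subset[OF _ cnt, of "(\<lambda>\<omega>. (X \<omega>, Y \<omega>)) ` space M"]
    by (auto simp: discretely_measurable_def events_of_def)
qed

lemma discretely_measurable_compose: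
  assumes "discretely_measurable M G X" "\<And>\<omega>. \<omega> \<in> space M \<Longrightarrow> Z \<omega> = f (X \<omega>)"
  shows "discretely_measurable M G Z"
proof -
  have "Z -` S \<inter> space M = X -` (f -` S) \<inter> space M" for S
    using assms(2) by auto
  then have "events_of M Z \<subseteq> events_of M X"
    by (auto simp: events_of_def)
  moreover have "Z ` space M = f ` X ` space M"
    using assms(2) by force
  ultimately show ?thesis
    using assms(1) by (auto simp: discretely_measurable_def)
qed

lemma discretely_measurable_measurable:
  assumes "discretely_measurable M G X" "G \<subseteq> sets M"
  shows "X \<in> M \<rightarrow>\<^sub>M count_space (X ` space M)"
  using assms by (auto simp: discretely_measurable_def events_of_def measurable_def)

lemma discretely_measurable_borel:
  assumes "discretely_measurable M G X" "G \<subseteq> sets M"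
  shows "(\<lambda>\<omega>. f (X \<omega>)) \<in> borel_measurable M"
  using discretely_measurable_measurable[OF assms] by (rule measurable_compose) simp

text \<open>
  Tonelli's theorem for the joint law of \<open>X\<close> and \<open>Y\<close>, which independence makes a product measure.
  Restricting the first factor to the countable range of \<open>X\<close> makes every function on the product
  measurable, so \<open>f\<close> can be arbitrary.
\<close>

lemma (in prob_space) nn_integral_independent_draw:
  fixes Y :: "'a \<Rightarrow> 'b::countable" and f :: "'c \<Rightarrow> 'b \<Rightarrow> ennreal"
  assumes X: "discretely_measurable M G X"
    and Y: "Y \<in> M \<rightarrow>\<^sub>M count_space UNIV"
    and indep: "indep_set (events_of M Y) G"
  shows "(\<integral>\<^sup>+\<omega>. f (X \<omega>) (Y \<omega>) \<partial>M)
    = (\<integral>\<^sup>+\<omega>. (\<integral>\<^sup>+v. f (X \<omega>) v \<partial>distr M (count_space UNIV) Y) \<partial>M)"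
proof -
  let ?R = "X ` space M" and ?P = "distr M (count_space UNIV) Y"
  interpret Y: prob_space ?P
    using Y by (rule prob_space_distr)
  have "G \<subseteq> sets M"
    using indep by (auto simp: indep_set_def indep_sets_def UNIV_bool)
  then have X': "X \<in> M \<rightarrow>\<^sub>M count_space ?R"
    by (rule discretely_measurable_measurable[OF X])
  have cnt: "countable ?R"
    using X by (simp add: discretely_measurable_def)
  have prod: "distr M (count_space ?R) X \<Otimes>\<^sub>M ?P
      = distr M (count_space ?R \<Otimes>\<^sub>M count_space UNIV) (\<lambda>\<omega>. (X \<omega>, Y \<omega>))"
  proof (rule pair_measure_eqI)
    show "sigma_finite_measure (distr M (count_space ?R) X)" "sigma_finite_measure ?P"
      using X' Y by (auto intro!: prob_space_imp_sigma_finite prob_space_distr)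
    show "sets (distr M (count_space ?R) X \<Otimes>\<^sub>M ?P)
        = sets (distr M (count_space ?R \<Otimes>\<^sub>M count_space UNIV) (\<lambda>\<omega>. (X \<omega>, Y \<omega>)))"
      unfolding sets_distr by (intro sets_pair_measure_cong) simp_all
  next
    fix S :: "'c set" and T :: "'b set"
    assume "S \<in> sets (distr M (count_space ?R) X)" "T \<in> sets ?P"
    then have S: "S \<subseteq> ?R"
      by simp
    have "X -` S \<inter> space M \<in> G" "Y -` T \<inter> space M \<in> events_of M Y"
      using X by (auto simp: discretely_measurable_def events_of_def)
    then have "prob ((Y -` T \<inter> space M) \<inter> (X -` S \<inter> space M))
        = prob (Y -` T \<inter> space M) * prob (X -` S \<inter> space M)"
      by (intro indep_setD[OF indep])
    moreover have "(\<lambda>\<omega>. (X \<omega>, Y \<omega>)) -` (S \<times> T) \<inter> space M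
        = (Y -` T \<inter> space M) \<inter> (X -` S \<inter> space M)"
      by auto
    moreover have "S \<times> T \<in> sets (count_space ?R \<Otimes>\<^sub>M (count_space UNIV :: 'b measure))"
      using S by (intro pair_measureI) simp_all
    ultimately show "emeasure (distr M (count_space ?R) X) S * emeasure ?P T
        = emeasure (distr M (count_space ?R \<Otimes>\<^sub>M count_space UNIV) (\<lambda>\<omega>. (X \<omega>, Y \<omega>))) (S \<times> T)"
      using X' Y S
      by (simp add: emeasure_distr emeasure_eq_measure measurable_Pair ennreal_mult'[symmetric] mult.commute)
  qed
  have f: "g \<in> borel_measurable (count_space ?R \<Otimes>\<^sub>M (count_space UNIV :: 'b measure))"
    for g :: "'c \<times> 'b \<Rightarrow> ennreal"
    using cnt by (subst pair_measure_countable) auto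
  have "(\<integral>\<^sup>+\<omega>. f (X \<omega>) (Y \<omega>) \<partial>M)
      = (\<integral>\<^sup>+z. case_prod f z \<partial>distr M (count_space ?R \<Otimes>\<^sub>M count_space UNIV) (\<lambda>\<omega>. (X \<omega>, Y \<omega>)))"
    using measurable_Pair[OF X' Y] by (simp add: nn_integral_distr f)
  also have "\<dots> = (\<integral>\<^sup>+u. (\<integral>\<^sup>+v. case_prod f (u, v) \<partial>?P) \<partial>distr M (count_space ?R) X)"
    unfolding prod[symmetric]
  proof (rule Y.nn_integral_fst[symmetric])
    show "case_prod f \<in> borel_measurable (distr M (count_space ?R) X \<Otimes>\<^sub>M ?P)"
      using f[of "case_prod f"]
      by (subst measurable_cong_sets[OF sets_pair_measure_cong refl]) simp_all
  qed
  also have "\<dots> = (\<integral>\<^sup>+\<omega>. (\<integral>\<^sup>+v. f (X \<omega>) v \<partial>?P) \<partial>M)"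
    using X' by (simp add: nn_integral_distr)
  finally show ?thesis .
qed

section \<open>The draws of the algorithm\<close>

lemma sigma_algebra_past: "sigma_algebra (space M) (past M \<xi> \<zeta> k)"
  unfolding past_def by (rule sigma_algebra_sigma_sets) (auto simp: events_of_def)

lemma past_Suc: "past M \<xi> \<zeta> k \<subseteq> past M \<xi> \<zeta> (Suc k)"
  unfolding past_def by (intro sigma_sets_mono' UN_mono) auto

lemma events_of_draw_subset_past_Suc:
  "events_of M (\<xi> k) \<subseteq> past M \<xi> \<zeta> (Suc k)"
  "events_of M (\<zeta> k) \<subseteq> past M \<xi> \<zeta> (Suc k)"
proof -
  have "events_of M (\<xi> k) \<union> events_of M (\<zeta> k)
      \<subseteq> (\<Union>j<Suc k. events_of M (\<xi> j) \<union> events_of M (\<zeta> j))"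
    by (rule UN_upper) simp
  then have "events_of M (\<xi> k) \<union> events_of M (\<zeta> k) \<subseteq> past M \<xi> \<zeta> (Suc k)"
    unfolding past_def using sigma_sets_superset_generator by (rule subset_trans)
  then show "events_of M (\<xi> k) \<subseteq> past M \<xi> \<zeta> (Suc k)"
      "events_of M (\<zeta> k) \<subseteq> past M \<xi> \<zeta> (Suc k)"
    by simp_all
qed

context prob_space
begin

lemma past_subset_sets:
  assumes "VRFBHF_draws M p Q \<xi> \<zeta>"
  shows "past M \<xi> \<zeta> k \<subseteq> sets M"
proof -
  have "indep_set (events_of M (\<xi> k)) (past M \<xi> \<zeta> k)"
    using assms by (simp add: VRFBHF_draws_def)
  then show ?thesis
    by (auto simp: indep_set_def indep_sets_def UNIV_bool)
qed

lemma coin_distribution: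
  assumes "VRFBHF_draws M p Q \<xi> \<zeta>" "0 \<le> p" "p \<le> 1"
  shows "distr M (count_space UNIV) (\<zeta> k) = measure_pmf (bernoulli_pmf p)"
proof (rule measure_eqI_countable[of _ UNIV])
  fix b :: bool
  have \<zeta>: "\<zeta> k \<in> M \<rightarrow>\<^sub>M count_space UNIV" and p: "prob {\<omega>\<in>space M. \<zeta> k \<omega>} = p"
    using assms(1) by (auto simp: VRFBHF_draws_def)
  have "{\<omega>\<in>space M. \<zeta> k \<omega>} \<in> events"
    using measurable_sets[OF \<zeta>, of "{True}"] by (simp add: vimage_def Int_def conj_commute)
  then have np: "prob {\<omega>\<in>space M. \<not> \<zeta> k \<omega>} = 1 - p"
    using p by (simp add: prob_neg)
  have "\<zeta> k -` {True} \<inter> space M = {\<omega>\<in>space M. \<zeta> k \<omega>}"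
       "\<zeta> k -` {False} \<inter> space M = {\<omega>\<in>space M. \<not> \<zeta> k \<omega>}"
    by auto
  then show "emeasure (distr M (count_space UNIV) (\<zeta> k)) {b} = emeasure (bernoulli_pmf p) {b}"
    using assms(2,3) p np \<zeta>
    by (cases b) (simp_all add: emeasure_distr emeasure_eq_measure emeasure_pmf_single)
qed auto

text \<open>
  The two draws of an iteration are integrated out one after the other. The coin goes first, since it
  is independent of the past and the oracle index together; the index is then independent of the past.
\<close>

lemma nn_integral_fresh_draws:
  fixes f :: "'c \<Rightarrow> nat \<Rightarrow> bool \<Rightarrow> ennreal"
  assumes draws: "VRFBHF_draws M p Q \<xi> \<zeta>" and p: "0 \<le> p" "p \<le> 1"
    and X: "discretely_measurable M (past M \<xi> \<zeta> k) X"
  shows "(\<integral>\<^sup>+\<omega>. f (X \<omega>) (\<xi> k \<omega>) (\<zeta> k \<omega>) \<partial>M)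
    = (\<integral>\<^sup>+\<omega>. (\<integral>\<^sup>+i. f (X \<omega>) i True * p + f (X \<omega>) i False * (1 - p) \<partial>Q) \<partial>M)"
proof -
  let ?G = "sigma_sets (space M) (past M \<xi> \<zeta> k \<union> events_of M (\<xi> k))"
  have \<xi>: "\<xi> k \<in> M \<rightarrow>\<^sub>M count_space UNIV" "distr M (count_space UNIV) (\<xi> k) = measure_pmf Q"
      "indep_set (events_of M (\<xi> k)) (past M \<xi> \<zeta> k)"
    and \<zeta>: "\<zeta> k \<in> M \<rightarrow>\<^sub>M count_space UNIV" "indep_set (events_of M (\<zeta> k)) ?G"
    using draws by (auto simp: VRFBHF_draws_def)
  have "past M \<xi> \<zeta> k \<union> events_of M (\<xi> k) \<subseteq> Pow (space M)"
    using past_subset_sets[OF draws] sets.space_closed[of M] by (auto simp: events_of_def)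
  then have G: "sigma_algebra (space M) ?G"
    by (rule sigma_algebra_sigma_sets)
  have "discretely_measurable M ?G X"
    using X by (rule discretely_measurable_mono) (auto intro: sigma_sets.Basic)
  moreover have "discretely_measurable M ?G (\<xi> k)"
    by (auto simp: discretely_measurable_def intro: sigma_sets.Basic)
  ultimately have X\<xi>: "discretely_measurable M ?G (\<lambda>\<omega>. (X \<omega>, \<xi> k \<omega>))"
    by (rule discretely_measurable_Pair[OF G])
  have "(\<integral>\<^sup>+\<omega>. f (X \<omega>) (\<xi> k \<omega>) (\<zeta> k \<omega>) \<partial>M)
      = (\<integral>\<^sup>+\<omega>. f (X \<omega>) (\<xi> k \<omega>) True * p + f (X \<omega>) (\<xi> k \<omega>) False * (1 - p) \<partial>M)"
    using nn_integral_independent_draw[OF X\<xi> \<zeta>, of "\<lambda>z. f (fst z) (snd z)"] p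
    by (simp add: coin_distribution[OF draws p])
  also have "\<dots> = (\<integral>\<^sup>+\<omega>. (\<integral>\<^sup>+i. f (X \<omega>) i True * p + f (X \<omega>) i False * (1 - p) \<partial>Q) \<partial>M)"
    using nn_integral_independent_draw[OF X \<xi>(1,3),
        of "\<lambda>u i. f u i True * p + f u i False * (1 - p)"]
    by (simp add: \<xi>(2))
  finally show ?thesis .
qed

end

section \<open>The iterates as a Markov chain\<close>

text \<open>
  A deterministic map from the state \<open>(x\<^sub>k, w\<^sub>k)\<close> and the oracle index to \<open>x\<^sub>k\<^sub>+\<^sub>1\<close>. The
  description operator stands for the value of the resolvent; it is meaningful at the states that the
  algorithm visits, where \<open>y\<^sub>k\<close> witnesses existence.
\<close>

definition corrected_point ::
    "('h::real_inner \<Rightarrow> 'h set) \<Rightarrow> ('h \<Rightarrow> 'h) \<Rightarrow> (nat \<Rightarrow> 'h \<Rightarrow> 'h) \<Rightarrow> ('h \<Rightarrow> 'h) \<Rightarrow> real \<Rightarrow> real \<Rightarrow>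
     'h \<times> 'h \<Rightarrow> nat \<Rightarrow> 'h" where
  "corrected_point A B Bo C \<gamma> lam s i =
     (let w = snd s;
          y = (THE y. y \<in> resolvent \<gamma> A ((lam *\<^sub>R fst s + (1 - lam) *\<^sub>R w) - \<gamma> *\<^sub>R (B w + C w)))
      in y + \<gamma> *\<^sub>R (Bo i w - Bo i y))"

definition transition ::
    "('h::real_inner \<Rightarrow> 'h set) \<Rightarrow> ('h \<Rightarrow> 'h) \<Rightarrow> (nat \<Rightarrow> 'h \<Rightarrow> 'h) \<Rightarrow> ('h \<Rightarrow> 'h) \<Rightarrow> real \<Rightarrow> real \<Rightarrow>
     'h \<times> 'h \<Rightarrow> nat \<Rightarrow> bool \<Rightarrow> 'h \<times> 'h" where
  "transition A B Bo C \<gamma> lam s i b =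
     (let x = corrected_point A B Bo C \<gamma> lam s i in (x, if b then x else snd s))"

lemma corrected_point_eq:
  assumes "monotone_op A" "\<gamma> \<ge> 0"
    and "y \<in> resolvent \<gamma> A ((lam *\<^sub>R u + (1 - lam) *\<^sub>R w) - \<gamma> *\<^sub>R (B w + C w))"
  shows "corrected_point A B Bo C \<gamma> lam (u, w) i = y + \<gamma> *\<^sub>R (Bo i w - Bo i y)"
proof -
  have "(THE y. y \<in> resolvent \<gamma> A ((lam *\<^sub>R u + (1 - lam) *\<^sub>R w) - \<gamma> *\<^sub>R (B w + C w))) = y"
    using assms resolvent_unique by (blast intro: the_equality)
  then show ?thesis
    by (simp add: corrected_point_def)
qed

lemma state_Suc:
  assumes "monotone_op A" "\<gamma> \<ge> 0" "VRFBHF M A B Bo C p Q \<gamma> lam x0 \<xi> \<zeta> x w y" "\<omega> \<in> space M"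
  shows "(x (Suc k) \<omega>, w (Suc k) \<omega>)
    = transition A B Bo C \<gamma> lam (x k \<omega>, w k \<omega>) (\<xi> k \<omega>) (\<zeta> k \<omega>)"
  using assms(3,4) corrected_point_eq[OF assms(1,2), of "y k \<omega>" lam "x k \<omega>" "w k \<omega>" B C]
  unfolding VRFBHF_def transition_def by (simp add: Let_def)

text \<open>
  Starting from a constant, each iteration applies a fixed map to the state and two discrete draws, so
  the range stays countable and no information beyond the past draws enters.
\<close>

lemma state_discretely_measurable:
  assumes "monotone_op A" "\<gamma> \<ge> 0" "VRFBHF M A B Bo C p Q \<gamma> lam x0 \<xi> \<zeta> x w y"
  shows "discretely_measurable M (past M \<xi> \<zeta> k) (\<lambda>\<omega>. (x k \<omega>, w k \<omega>))"
proof (induction k)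
  case 0
  have "(x 0 \<omega>, w 0 \<omega>) = (x0, x0)" if "\<omega> \<in> space M" for \<omega>
    using assms(3) that by (simp add: VRFBHF_def)
  then show ?case
    by (rule discretely_measurable_const[OF sigma_algebra_past])
next
  case (Suc k)
  let ?G = "past M \<xi> \<zeta> (Suc k)"
  have state: "discretely_measurable M ?G (\<lambda>\<omega>. (x k \<omega>, w k \<omega>))"
    using Suc.IH past_Suc by (rule discretely_measurable_mono)
  have draws: "discretely_measurable M ?G (\<xi> k)" "discretely_measurable M ?G (\<zeta> k)"
    using events_of_draw_subset_past_Suc[of M _ k]
    by (simp_all add: discretely_measurable_def)
  have "discretely_measurable M ?G (\<lambda>\<omega>. ((x k \<omega>, w k \<omega>), (\<xi> k \<omega>, \<zeta> k \<omega>)))"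
    by (rule discretely_measurable_Pair[OF sigma_algebra_past state
        discretely_measurable_Pair[OF sigma_algebra_past draws]])
  then show ?case
    by (rule discretely_measurable_compose[where f = "\<lambda>(s, i, b). transition A B Bo C \<gamma> lam s i b"])
      (simp add: state_Suc[OF assms])
qed

definition lyapunov :: "real \<Rightarrow> 'h::real_inner \<Rightarrow> 'h \<times> 'h \<Rightarrow> real" where
  "lyapunov p a s = (1 - p) * (norm (fst s - a))\<^sup>2 + (norm (snd s - a))\<^sup>2"

lemma lyapunov_nonneg: "p \<le> 1 \<Longrightarrow> 0 \<le> lyapunov p a s"
  by (simp add: lyapunov_def)

text \<open>
  The coefficient of the new distance is \<open>p (2 - p) + (1 - p)\<^sup>2 = 1\<close>, which is what makes the weight
  \<open>1 - p\<close> in \<open>lyapunov\<close> the right one.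
\<close>

lemma lyapunov_coin_average:
  assumes "0 \<le> p" "p \<le> 1"
  shows "ennreal (lyapunov p a (transition A B Bo C \<gamma> lam s i True)) * p
      + ennreal (lyapunov p a (transition A B Bo C \<gamma> lam s i False)) * (1 - p)
    = ennreal ((norm (corrected_point A B Bo C \<gamma> lam s i - a))\<^sup>2 + (1 - p) * (norm (snd s - a))\<^sup>2)"
proof -
  have "ennreal (lyapunov p a (transition A B Bo C \<gamma> lam s i True)) * p
      + ennreal (lyapunov p a (transition A B Bo C \<gamma> lam s i False)) * (1 - p)
    = ennreal (lyapunov p a (transition A B Bo C \<gamma> lam s i True) * p
      + lyapunov p a (transition A B Bo C \<gamma> lam s i False) * (1 - p))"
    using assms lyapunov_nonneg[OF assms(2), of a]
    by (simp add: ennreal_mult'')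
  also have "\<dots> = ennreal ((norm (corrected_point A B Bo C \<gamma> lam s i - a))\<^sup>2
      + (1 - p) * (norm (snd s - a))\<^sup>2)"
    by (rule arg_cong[of _ _ ennreal]) (simp add: lyapunov_def transition_def Let_def algebra_simps)
  finally show ?thesis .
qed

section \<open>Linear convergence\<close>

theorem theorem2p2:
  fixes A :: "'h::{real_inner,banach,second_countable_topology} \<Rightarrow> 'h set"
    and Bs :: "nat \<Rightarrow> 'h \<Rightarrow> 'h" and B :: "'h \<Rightarrow> 'h" and Bo :: "nat \<Rightarrow> 'h \<Rightarrow> 'h" and C :: "'h \<Rightarrow> 'h"
    and N :: nat and Ls :: "nat \<Rightarrow> real" and Q :: "nat pmf"
    and L \<beta> \<mu> p lam \<gamma> c :: real and xs x0 :: 'h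
    and M :: "'w measure" and \<xi> :: "nat \<Rightarrow> 'w \<Rightarrow> nat" and \<zeta> :: "nat \<Rightarrow> 'w \<Rightarrow> bool"
    and x w y :: "nat \<Rightarrow> 'w \<Rightarrow> 'h" and k :: nat
  assumes "maximally_monotone A"
    and "B = (\<lambda>z. \<Sum>i=1..N. Bs i z)"
    and "\<And>i. i \<in> {1..N} \<Longrightarrow> (Ls i)-lipschitz_on UNIV (Bs i)"
    and "set_pmf Q \<subseteq> {1..N}"
    and "unbiased_oracle Q Bo B"
    and "L > 0" and "lipschitz_in_mean L Q Bo"
    and "\<beta> > 0" and "cocoercive \<beta> C"
    and "solution_set A B C \<noteq> {}"
    and "\<mu> > 0" and "strongly_monotone \<mu> B"
    and "xs \<in> solution_set A B C"
    and "0 < p" and "p < 1"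
    and "lam = 1 - p"
    and "\<gamma> = min (sqrt p / (2 * L)) (\<beta> * p)"
    and "c = min (\<gamma> * \<mu>) (p / ((1 + sqrt p) * (4 + p)))"
    and "prob_space M"
    and "VRFBHF M A B Bo C p Q \<gamma> lam x0 \<xi> \<zeta> x w y"
  shows "integrable M (\<lambda>\<omega>. (norm (x k \<omega> - xs))\<^sup>2) \<and>
    prob_space.expectation M (\<lambda>\<omega>. (norm (x k \<omega> - xs))\<^sup>2)
      \<le> (1 / (1 + c / 4)) ^ k * (2 / (1 - p)) * (norm (x0 - xs))\<^sup>2"
proof -
  interpret prob_space M by fact
  have A: "monotone_op A"
    using assms(1) by (simp add: maximally_monotone_def)
  have fin: "finite (set_pmf Q)"
    using assms(4) by (rule finite_subset) simp
  have \<gamma>: "\<gamma> > 0" "\<gamma> \<le> \<beta> * p"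
    using assms(6,8,14,17) by auto
  have \<gamma>L: "\<gamma>\<^sup>2 * L\<^sup>2 \<le> p / 4"
  proof -
    have "\<gamma> * L \<le> sqrt p / (2 * L) * L"
      using assms(6,17) by (intro mult_right_mono) auto
    then have "\<gamma> * L \<le> sqrt p / 2"
      using assms(6) by simp
    then have "(\<gamma> * L)\<^sup>2 \<le> (sqrt p / 2)\<^sup>2"
      using \<gamma>(1) assms(6) by (intro power_mono) auto
    then show ?thesis
      using assms(14) by (simp add: power_mult_distrib power_divide)
  qed
  have c: "0 \<le> c" "c \<le> \<gamma> * \<mu>" "c \<le> p / ((1 + sqrt p) * (4 + p))"
    using assms(11,14,18) \<gamma>(1) by auto
  note alg = assms(20)
  have draws: "VRFBHF_draws M p Q \<xi> \<zeta>"
    using alg by (simp add: VRFBHF_def)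
  define S where "S k \<omega> = (x k \<omega>, w k \<omega>)" for k \<omega>
  define \<Phi> where "\<Phi> = lyapunov p xs"
  define r where "r = 1 / (1 + c / 4)"
  have r: "0 \<le> r"
    using c(1) by (simp add: r_def)
  have \<Phi>_nonneg: "0 \<le> \<Phi> s" for s
    using assms(15) by (simp add: \<Phi>_def lyapunov_nonneg)
  have S: "discretely_measurable M (past M \<xi> \<zeta> k) (S k)" for k
    unfolding S_def using \<gamma>(1) by (intro state_discretely_measurable[OF A _ alg]) simp
  have meas: "(\<lambda>\<omega>. f (S k \<omega>)) \<in> borel_measurable M" for f :: "'h \<times> 'h \<Rightarrow> real" and k
    using S past_subset_sets[OF draws] by (rule discretely_measurable_borel)

  have step: "(\<integral>\<^sup>+\<omega>. \<Phi> (S (Suc k) \<omega>) \<partial>M) \<le> ennreal r * (\<integral>\<^sup>+\<omega>. \<Phi> (S k \<omega>) \<partial>M)" for k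
  proof -
    let ?T = "transition A B Bo C \<gamma> lam" and ?x = "corrected_point A B Bo C \<gamma> lam"
    have "(\<integral>\<^sup>+\<omega>. \<Phi> (S (Suc k) \<omega>) \<partial>M) = (\<integral>\<^sup>+\<omega>. \<Phi> (?T (S k \<omega>) (\<xi> k \<omega>) (\<zeta> k \<omega>)) \<partial>M)"
      using \<gamma>(1) by (intro nn_integral_cong) (simp add: S_def state_Suc[OF A _ alg])
    also have "\<dots> = (\<integral>\<^sup>+\<omega>. (\<integral>\<^sup>+i. ennreal (\<Phi> (?T (S k \<omega>) i True)) * p
        + ennreal (\<Phi> (?T (S k \<omega>) i False)) * (1 - p) \<partial>Q) \<partial>M)"
      using assms(14,15)
      by (intro nn_integral_fresh_draws[OF draws _ _ S, where f = "\<lambda>s i b. ennreal (\<Phi> (?T s i b))"]) auto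
    also have "\<dots> \<le> (\<integral>\<^sup>+\<omega>. ennreal r * ennreal (\<Phi> (S k \<omega>)) \<partial>M)"
    proof (rule nn_integral_mono)
      fix \<omega> assume \<omega>: "\<omega> \<in> space M"
      let ?E = "measure_pmf.expectation Q (\<lambda>i. (norm (?x (S k \<omega>) i - xs))\<^sup>2)"
      have y: "y k \<omega> \<in> resolvent \<gamma> A (((1 - p) *\<^sub>R x k \<omega> + p *\<^sub>R w k \<omega>)
          - \<gamma> *\<^sub>R (B (w k \<omega>) + C (w k \<omega>)))"
        using alg \<omega> assms(16) by (simp add: VRFBHF_def)
      have x_eq: "?x (S k \<omega>) i = y k \<omega> + \<gamma> *\<^sub>R (Bo i (w k \<omega>) - Bo i (y k \<omega>))" for i
        unfolding S_def using \<gamma>(1) y assms(16) by (intro corrected_point_eq[OF A]) auto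
      have "(\<integral>\<^sup>+i. ennreal (\<Phi> (?T (S k \<omega>) i True)) * p
            + ennreal (\<Phi> (?T (S k \<omega>) i False)) * (1 - p) \<partial>Q)
          = (\<integral>\<^sup>+i. ennreal ((norm (?x (S k \<omega>) i - xs))\<^sup>2 + (1 - p) * (norm (w k \<omega> - xs))\<^sup>2) \<partial>Q)"
        using assms(14,15) unfolding \<Phi>_def
        by (subst lyapunov_coin_average) (auto simp: S_def)
      also have "\<dots> = ennreal (measure_pmf.expectation Q
          (\<lambda>i. (norm (?x (S k \<omega>) i - xs))\<^sup>2 + (1 - p) * (norm (w k \<omega> - xs))\<^sup>2))"
        using assms(15) by (intro nn_integral_eq_integral integrable_measure_pmf_finite[OF fin]) auto
      also have "\<dots> = ennreal (?E + (1 - p) * (norm (w k \<omega> - xs))\<^sup>2)"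
        by (simp add: integrable_measure_pmf_finite[OF fin])
      also have "\<dots> \<le> ennreal (r * \<Phi> (S k \<omega>))"
      proof (rule ennreal_leI)
        have "(1 + c / 4) * (?E + (1 - p) * (norm (w k \<omega> - xs))\<^sup>2) \<le> \<Phi> (S k \<omega>)"
          using lyapunov_contraction[OF A assms(13,9,8,12) fin assms(5,7,14,15) \<gamma> \<gamma>L c y]
          unfolding x_eq by (simp add: \<Phi>_def lyapunov_def S_def)
        then show "?E + (1 - p) * (norm (w k \<omega> - xs))\<^sup>2 \<le> r * \<Phi> (S k \<omega>)"
          using c(1) by (simp add: r_def field_simps)
      qed
      also have "\<dots> = ennreal r * ennreal (\<Phi> (S k \<omega>))"
        using r by (rule ennreal_mult')
      finally show "(\<integral>\<^sup>+i. ennreal (\<Phi> (?T (S k \<omega>) i True)) * p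
            + ennreal (\<Phi> (?T (S k \<omega>) i False)) * (1 - p) \<partial>Q) \<le> ennreal r * ennreal (\<Phi> (S k \<omega>))" .
    qed
    also have "\<dots> = ennreal r * (\<integral>\<^sup>+\<omega>. \<Phi> (S k \<omega>) \<partial>M)"
      using meas by (intro nn_integral_cmult) simp
    finally show ?thesis .
  qed

  have decay: "(\<integral>\<^sup>+\<omega>. \<Phi> (S k \<omega>) \<partial>M) \<le> ennreal (r ^ k * \<Phi> (x0, x0))" for k
  proof (induction k)
    case 0
    have "(\<integral>\<^sup>+\<omega>. \<Phi> (S 0 \<omega>) \<partial>M) = (\<integral>\<^sup>+\<omega>. \<Phi> (x0, x0) \<partial>M)"
      using alg by (intro nn_integral_cong) (simp add: S_def VRFBHF_def)
    then show ?case
      by (simp add: emeasure_space_1)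
  next
    case (Suc k)
    have "(\<integral>\<^sup>+\<omega>. \<Phi> (S (Suc k) \<omega>) \<partial>M) \<le> ennreal r * ennreal (r ^ k * \<Phi> (x0, x0))"
      using step[of k] mult_left_mono[OF Suc.IH, of "ennreal r"] by (auto intro: order_trans)
    then show ?case
      using r by (simp add: ennreal_mult'[symmetric] mult.assoc)
  qed

  define b where "b = r ^ k * (2 / (1 - p)) * (norm (x0 - xs))\<^sup>2"
  have b: "0 \<le> b"
    using r assms(15) by (simp add: b_def)
  have "(\<integral>\<^sup>+\<omega>. (norm (x k \<omega> - xs))\<^sup>2 \<partial>M) \<le> (\<integral>\<^sup>+\<omega>. ennreal (1 / (1 - p)) * ennreal (\<Phi> (S k \<omega>)) \<partial>M)"
    using assms(15) \<Phi>_nonneg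
    by (intro nn_integral_mono)
      (auto simp: ennreal_mult'[symmetric] \<Phi>_def lyapunov_def S_def field_simps intro!: ennreal_leI)
  also have "\<dots> = ennreal (1 / (1 - p)) * (\<integral>\<^sup>+\<omega>. \<Phi> (S k \<omega>) \<partial>M)"
    using meas by (intro nn_integral_cmult) simp
  also have "\<dots> \<le> ennreal (1 / (1 - p)) * ennreal (r ^ k * \<Phi> (x0, x0))"
    by (intro mult_left_mono decay) simp
  also have "\<dots> = ennreal (r ^ k * (1 / (1 - p)) * \<Phi> (x0, x0))"
    using assms(15) by (simp add: ennreal_mult'[symmetric] mult_ac)
  also have "\<dots> \<le> ennreal b"
  proof (rule ennreal_leI)
    have "\<Phi> (x0, x0) \<le> 2 * (norm (x0 - xs))\<^sup>2"
      using assms(14) by (simp add: \<Phi>_def lyapunov_def algebra_simps)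
    then have "r ^ k * (1 / (1 - p)) * \<Phi> (x0, x0) \<le> r ^ k * (1 / (1 - p)) * (2 * (norm (x0 - xs))\<^sup>2)"
      using r assms(15) by (intro mult_left_mono) auto
    then show "r ^ k * (1 / (1 - p)) * \<Phi> (x0, x0) \<le> b"
      by (simp add: b_def)
  qed
  finally have bound: "(\<integral>\<^sup>+\<omega>. (norm (x k \<omega> - xs))\<^sup>2 \<partial>M) \<le> ennreal b" .
  have "(\<lambda>\<omega>. (norm (x k \<omega> - xs))\<^sup>2) \<in> borel_measurable M"
    using meas[of "\<lambda>s. (norm (fst s - xs))\<^sup>2" k] by (simp add: S_def)
  then have "integrable M (\<lambda>\<omega>. (norm (x k \<omega> - xs))\<^sup>2)"
    using bound by (intro integrableI_bounded) (auto simp: ennreal_less_top intro: le_less_trans)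
  moreover have "expectation (\<lambda>\<omega>. (norm (x k \<omega> - xs))\<^sup>2) \<le> b"
    using b bound by (rule integral_real_bounded)
  ultimately show ?thesis
    by (simp add: b_def r_def)
qed

end
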